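(* Let $\rho$ be a certainty equivalent, $L:\mathcal{D}\to\mathbb{R}$ an increasing loss function and $C\in\mathbb{R}$ with $C>L(0)$, and consider the associated notion of validity: for every family of tests $\phi$ and every data-dependent level $\widetilde{\alpha}$, $$\phi \text{ is valid for } \widetilde{\alpha} \iff \rho\big(\mathbb{E}^P[L(\phi(\widetilde{\alpha}))\mid\widetilde{\alpha}]\big)\le C .$$ Assume that $\rho$ is continuous from below, and that this notion of validity nests classical validity, preserves classical validity, and is monotone. Write $\overline{L}(x)=(L(x)-L(0))/(C-L(0))$ for $x\in\mathcal{D}$. Then $\overline{L}(d_\alpha)=1/\alpha$ for every $\alpha\in(0,1)$, and for every family of tests $\phi$ and every data-dependent level $\widetilde{\alpha}$ we have $$\phi \text{ is valid for } \widetilde{\alpha}\iff \mathbb{E}^P[\overline{L}(\phi(\widetilde{\alpha}))]\le 1 .$$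
   Context: Setting. $\mathcal{X}$ is the sample space, equipped with a probability distribution $P$ (the simple null hypothesis). External randomization is available throughout: the probability space may be enriched, whenever needed, with a random variable $U\sim\mathrm{Unif}[0,1]$ independent of any other random variables being considered; equivalently, treat the underlying probability space as rich enough that for every finite family of random variables there is on it a $\mathrm{Unif}[0,1]$ random variable independent of that family. Random variables are identified when $P$-almost surely equal (in particular as arguments of $\rho$), and all maps whose probabilities or expectations are considered are assumed measurable. Conditional expectations of random variables bounded from below are taken in the generalized sense, with values in $(-\infty,\infty]$. Evidence space. $\mathcal{D}$ is a totally ordered set with least element $0$, containing for each $\alpha\in(0,1)$ an element $d_\alpha$ (the decision to reject at level $\alpha$), such that $d_{\alpha^+}\le d_{\alpha^-}$ whenever $\alpha^-\le\alpha^+$. The element $0$ represents a non-rejection. Tests. A family of tests $\phi$ is a collection of random variables $\phi(\alpha):\mathcal{X}\to\{0,d_\alpha\}$, $\alpha\in(0,1)$. A data-dependent level is a random variable $\widetilde{\alpha}:\mathcal{X}\to(0,1)$, and $\phi(\widetilde{\alpha})$ denotes the $\mathcal{D}$-valued map $x\mapsto\phi(\widetilde{\alpha}(x))(x)$. Classical validity: $\phi$ is valid at the (fixed) level $\alpha$ if $P(\phi(\alpha)=d_\alpha)\le\alpha$. Certainty equivalents. A certainty equivalent is a map $\rho$ from $[L(0),\infty]$-valued random variables to $[L(0),\infty]$ such that $X\equiv c$ implies $\rho(X)=c$. It is continuous from below if $Y_n\uparrow Y$ implies $\rho(Y_n)\uparrow\rho(Y)$. Axioms for a notion of validity "$\phi$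 is valid for $\widetilde{\alpha}$": (Nesting classical validity) for every $\alpha\in(0,1)$ and every family of tests $\phi$, $\phi$ is valid for the constant level $\widetilde{\alpha}\equiv\alpha$ if and only if $P(\phi(\alpha)=d_\alpha)\le\alpha$. (Preserving classical validity) for all $\phi,\widetilde{\alpha}$: if $\phi$ is valid for $\widetilde{\alpha}$, then $P(\phi(\widetilde{\alpha})\ge d_\alpha)\le\alpha$ for every $\alpha\in(0,1)$. (Monotonicity) for all $\phi,\widetilde{\alpha},\widetilde{\alpha}'$: if $\phi$ is valid for $\widetilde{\alpha}$ and $\phi(\widetilde{\alpha}')\le\phi(\widetilde{\alpha})$ pointwise, then $\phi$ is valid for $\widetilde{\alpha}'$. *)

theory Defs
  imports "HOL-Probability.Probability"
begin

text \<open>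
  The sample space with its distribution is a probability space \<open>M\<close>. The evidence space is a
  type \<open>'d\<close> of class \<open>{linorder, order_bot}\<close>, whose least element \<open>bot\<close> is the non-rejection
  (written 0 on paper), with the rejections \<open>d \<alpha>\<close> for \<open>0 < \<alpha> < 1\<close>. A family of tests is a function
  \<open>\<phi> :: real \<Rightarrow> 'a \<Rightarrow> 'd\<close> whose values at levels outside the open unit interval are irrelevant.
\<close>

definition external_randomization :: "'a measure \<Rightarrow> bool" where
  "external_randomization M \<longleftrightarrow>
     (\<forall>n (X :: nat \<Rightarrow> 'a \<Rightarrow> real). (\<forall>i<n. X i \<in> borel_measurable M) \<longrightarrow>
        (\<exists>U :: 'a \<Rightarrow> real. U \<in> borel_measurable M \<and>
             distr M borel U = uniform_measure lborel {0..1} \<and>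
             prob_space.indep_set M
               (sets (vimage_algebra (space M) U borel))
               (sets (vimage_algebra (space M) (\<lambda>x. \<lambda>i\<in>{..<n}. X i x)
                        (PiM {..<n} (\<lambda>_. borel :: real measure))))))"

definition evidence_levels :: "(real \<Rightarrow> 'd::{linorder, order_bot}) \<Rightarrow> bool" where
  "evidence_levels d \<longleftrightarrow> monotone_on {0<..<1} (\<le>) (\<ge>) d"

definition test_family ::
    "'a measure \<Rightarrow> (real \<Rightarrow> 'd::{linorder, order_bot}) \<Rightarrow> (real \<Rightarrow> 'a \<Rightarrow> 'd) \<Rightarrow> bool" where
  "test_family M d \<phi> \<longleftrightarrow>
     (\<forall>\<alpha>\<in>{0<..<1}. (\<forall>x\<in>space M. \<phi> \<alpha> x \<in> {bot, d \<alpha>}) \<and>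
                   {x \<in> space M. \<phi> \<alpha> x = d \<alpha>} \<in> sets M)"

definition data_dependent_level :: "'a measure \<Rightarrow> ('a \<Rightarrow> real) \<Rightarrow> bool" where
  "data_dependent_level M a \<longleftrightarrow> a \<in> borel_measurable M \<and> (\<forall>x\<in>space M. a x \<in> {0<..<1})"

text \<open>The evidence at a data-dependent level: the level is read off the same sample point.\<close>

definition test_at :: "(real \<Rightarrow> 'a \<Rightarrow> 'd) \<Rightarrow> ('a \<Rightarrow> real) \<Rightarrow> 'a \<Rightarrow> 'd" where
  "test_at \<phi> a = (\<lambda>x. \<phi> (a x) x)"

text \<open>
  As \<open>\<phi>\<close> is an uncountable family, measurability of each \<open>\<phi> \<alpha>\<close> and of the level does not make
  \<open>test_at \<phi> a\<close> measurable. It is required here exactly for the loss and the events whose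
  expectation and probabilities are considered; no sigma-algebra on \<open>'d\<close> is needed.
\<close>

definition admissible ::
    "'a measure \<Rightarrow> (real \<Rightarrow> 'd::{linorder, order_bot}) \<Rightarrow> ('d \<Rightarrow> real) \<Rightarrow>
     (real \<Rightarrow> 'a \<Rightarrow> 'd) \<Rightarrow> ('a \<Rightarrow> real) \<Rightarrow> bool" where
  "admissible M d L \<phi> a \<longleftrightarrow>
     test_family M d \<phi> \<and> data_dependent_level M a \<and>
     (\<lambda>x. L (test_at \<phi> a x)) \<in> borel_measurable M \<and>
     (\<forall>\<alpha>\<in>{0<..<1}. {x \<in> space M. d \<alpha> \<le> test_at \<phi> a x} \<in> sets M)"

definition classically_valid ::
    "'a measure \<Rightarrow> (real \<Rightarrow> 'd) \<Rightarrow> (real \<Rightarrow> 'a \<Rightarrow> 'd) \<Rightarrow> real \<Rightarrow> bool" where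
  "classically_valid M d \<phi> \<alpha> \<longleftrightarrow> measure M {x \<in> space M. \<phi> \<alpha> x = d \<alpha>} \<le> \<alpha>"

text \<open>
  The functions with values in \<open>[l, \<infinity>]\<close> on which a certainty equivalent acts, up to null sets. The
  certainty equivalent is a function on representatives that respects almost sure equality.
\<close>

definition rv_ge :: "'a measure \<Rightarrow> ereal \<Rightarrow> ('a \<Rightarrow> ereal) set" where
  "rv_ge M l = {Y \<in> borel_measurable M. AE x in M. l \<le> Y x}"

definition certainty_equivalent ::
    "'a measure \<Rightarrow> ereal \<Rightarrow> (('a \<Rightarrow> ereal) \<Rightarrow> ereal) \<Rightarrow> bool" where
  "certainty_equivalent M l \<rho> \<longleftrightarrow>
     (\<forall>Y\<in>rv_ge M l. l \<le> \<rho> Y) \<and>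
     (\<forall>X\<in>rv_ge M l. \<forall>Y\<in>rv_ge M l. (AE x in M. X x = Y x) \<longrightarrow> \<rho> X = \<rho> Y) \<and>
     (\<forall>c\<ge>l. \<rho> (\<lambda>_. c) = c)"

definition continuous_from_below ::
    "'a measure \<Rightarrow> ereal \<Rightarrow> (('a \<Rightarrow> ereal) \<Rightarrow> ereal) \<Rightarrow> bool" where
  "continuous_from_below M l \<rho> \<longleftrightarrow>
     (\<forall>Y\<in>rv_ge M l. \<forall>Z. (\<forall>n. Z n \<in> rv_ge M l) \<longrightarrow>
        (AE x in M. incseq (\<lambda>n. Z n x) \<and> (\<lambda>n. Z n x) \<longlonglongrightarrow> Y x) \<longrightarrow>
        incseq (\<lambda>n. \<rho> (Z n)) \<and> (\<lambda>n. \<rho> (Z n)) \<longlonglongrightarrow> \<rho> Y)"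

text \<open>
  Conditional expectation in the generalized sense, for \<open>f\<close> bounded from below but not necessarily
  integrable. It is \<open>real_cond_exp\<close> without the final truncation to the reals, which would
  send an infinite conditional expectation to 0. As the negative part of \<open>f\<close> is bounded, the
  subtrahend is almost surely finite.
\<close>

definition gen_cond_exp ::
    "'a measure \<Rightarrow> 'a measure \<Rightarrow> ('a \<Rightarrow> real) \<Rightarrow> 'a \<Rightarrow> ereal" where
  "gen_cond_exp M F f = (\<lambda>x.
     enn2ereal (nn_cond_exp M F (\<lambda>y. ennreal (f y)) x) -
     enn2ereal (nn_cond_exp M F (\<lambda>y. ennreal (- f y)) x))"

definition valid_for ::
    "'a measure \<Rightarrow> (('a \<Rightarrow> ereal) \<Rightarrow> ereal) \<Rightarrow> ('d \<Rightarrow> real) \<Rightarrow> real \<Rightarrow>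
     (real \<Rightarrow> 'a \<Rightarrow> 'd) \<Rightarrow> ('a \<Rightarrow> real) \<Rightarrow> bool" where
  "valid_for M \<rho> L C \<phi> a \<longleftrightarrow>
     \<rho> (gen_cond_exp M (vimage_algebra (space M) a borel) (\<lambda>x. L (test_at \<phi> a x))) \<le> ereal C"

text \<open>
  The axioms for an arbitrary notion of validity \<open>V\<close>. The loss \<open>L\<close> enters only through the
  measurability requirement in \<open>admissible\<close>. For a constant level that requirement holds for every
  family of tests, so the first axiom does not mention it.
\<close>

definition nests_classical ::
    "'a measure \<Rightarrow> (real \<Rightarrow> 'd::{linorder, order_bot}) \<Rightarrow>
     ((real \<Rightarrow> 'a \<Rightarrow> 'd) \<Rightarrow> ('a \<Rightarrow> real) \<Rightarrow> bool) \<Rightarrow> bool" where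
  "nests_classical M d V \<longleftrightarrow>
     (\<forall>\<alpha>\<in>{0<..<1}. \<forall>\<phi>. test_family M d \<phi> \<longrightarrow>
        (V \<phi> (\<lambda>_. \<alpha>) \<longleftrightarrow> classically_valid M d \<phi> \<alpha>))"

definition preserves_classical ::
    "'a measure \<Rightarrow> (real \<Rightarrow> 'd::{linorder, order_bot}) \<Rightarrow> ('d \<Rightarrow> real) \<Rightarrow>
     ((real \<Rightarrow> 'a \<Rightarrow> 'd) \<Rightarrow> ('a \<Rightarrow> real) \<Rightarrow> bool) \<Rightarrow> bool" where
  "preserves_classical M d L V \<longleftrightarrow>
     (\<forall>\<phi> a. admissible M d L \<phi> a \<longrightarrow> V \<phi> a \<longrightarrow>
        (\<forall>\<alpha>\<in>{0<..<1}. measure M {x \<in> space M. d \<alpha> \<le> test_at \<phi> a x} \<le> \<alpha>))"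

definition monotone_validity ::
    "'a measure \<Rightarrow> (real \<Rightarrow> 'd::{linorder, order_bot}) \<Rightarrow> ('d \<Rightarrow> real) \<Rightarrow>
     ((real \<Rightarrow> 'a \<Rightarrow> 'd) \<Rightarrow> ('a \<Rightarrow> real) \<Rightarrow> bool) \<Rightarrow> bool" where
  "monotone_validity M d L V \<longleftrightarrow>
     (\<forall>\<phi> a a'. admissible M d L \<phi> a \<longrightarrow> admissible M d L \<phi> a' \<longrightarrow> V \<phi> a \<longrightarrow>
        (\<forall>x\<in>space M. test_at \<phi> a' x \<le> test_at \<phi> a x) \<longrightarrow> V \<phi> a')"

definition normalized_loss :: "('d::order_bot \<Rightarrow> real) \<Rightarrow> real \<Rightarrow> 'd \<Rightarrow> real" where
  "normalized_loss L C x = (L x - L bot) / (C - L bot)"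

end

theory Submission
  imports Defs
begin

text \<open>
  Testing at a constant level gives a constant conditional loss, so nesting classical validity on
  events of every probability forces the normalized loss of \<open>d \<alpha>\<close> to be \<open>1 / \<alpha>\<close>. In general
  validity depends only on the normalized conditional loss \<open>V\<close> given the level. By external
  randomization, a bounded \<open>V\<close> is also the conditional loss of a test that rejects on an event \<open>A\<close> at
  a level \<open>a\<close> confined to an interval \<open>[c h, h]\<close> with \<open>c < 1\<close>, where \<open>h\<close> is small and
  \<open>P A = E[V a]\<close>. If this test is valid, preservation at level \<open>h\<close> gives \<open>c h E V \<le> P A \<le> h\<close>. If
  instead \<open>E V \<le> c\<close>, then \<open>P A \<le> c h\<close>, so rejecting on \<open>A\<close> is valid at the constant level \<open>c h\<close>, and
  monotonicity carries this over to the weaker rejections at level \<open>a\<close>. Letting \<open>c\<close> tend to 1 and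
  truncating, continuity from below yields both directions for all \<open>V\<close>.
\<close>

section \<open>Randomized rejection with a prescribed conditional probability\<close>

text \<open>The randomizer is requested for the family whose only member is \<open>y\<close>.
  Independence of the one-entry tuple passes to \<open>y\<close>, because \<open>y\<close> is a
  coordinate of that tuple and so generates a sub-sigma-algebra.\<close>

lemma (in prob_space) independent_uniform:
  fixes y :: "'a \<Rightarrow> real"
  assumes "external_randomization M" and y[measurable]: "y \<in> borel_measurable M"
  obtains U where "U \<in> borel_measurable M" "distr M borel U = uniform_measure lborel {0..1}"
    "indep_var borel U borel y"
proof -
  let ?T = "\<lambda>x. \<lambda>i\<in>{..<1::nat}. y x"
  let ?P = "PiM {..<1::nat} (\<lambda>_. borel :: real measure)"
  have "\<exists>U :: 'a \<Rightarrow> real. U \<in> borel_measurable M \<and> distr M borel U = uniform_measure lborel {0..1} \<and>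
      indep_set (sets (vimage_algebra (space M) U borel)) (sets (vimage_algebra (space M) ?T ?P))"
    using assms(1)[unfolded external_randomization_def, rule_format, of 1 "\<lambda>_. y"] y by simp
  then obtain U :: "'a \<Rightarrow> real" where U: "U \<in> borel_measurable M" "distr M borel U = uniform_measure lborel {0..1}"
    and ind: "indep_set (sets (vimage_algebra (space M) U borel))
                        (sets (vimage_algebra (space M) ?T ?P))"
    by blast
  have sub: "sets (vimage_algebra (space M) y borel) \<subseteq> sets (vimage_algebra (space M) ?T ?P)"
  proof (rule sets_image_in_sets)
    have T: "?T \<in> measurable (vimage_algebra (space M) ?T ?P) ?P"
      by (rule measurable_vimage_algebra1) (auto simp: space_PiM)
    have "(\<lambda>x. ?T x 0) \<in> measurable (vimage_algebra (space M) ?T ?P) borel"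
      by (rule measurable_compose[OF T measurable_component_singleton]) simp
    then show "y \<in> measurable (vimage_algebra (space M) ?T ?P) borel"
      by simp
  qed simp
  have "indep_set (sets (vimage_algebra (space M) U borel)) (sets (vimage_algebra (space M) y borel))"
    using ind sub unfolding indep_sets2_eq by blast
  then have "indep_var borel U borel y"
    unfolding indep_var_eq using U(1) y by (simp add: sets_vimage_algebra)
  then show ?thesis
    using that U by blast
qed

text \<open>Given \<open>y\<close>, the independent uniform \<open>U\<close> falls below
  \<open>g y\<close> with probability exactly \<open>g y\<close>; the weight \<open>h\<close> tests
  this against functions of \<open>y\<close>. The proof is Tonelli on the product law of
  \<open>U\<close> and \<open>y\<close>.\<close>

lemma (in prob_space) nn_integral_threshold:
  fixes U y :: "'a \<Rightarrow> real" and g :: "real \<Rightarrow> real" and h :: "real \<Rightarrow> ennreal"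
  assumes U: "distr M borel U = uniform_measure lborel {0..1}"
    and ind: "indep_var borel U borel y"
    and [measurable]: "g \<in> borel_measurable borel" "h \<in> borel_measurable borel"
    and g: "\<And>x. x \<in> space M \<Longrightarrow> 0 \<le> g (y x) \<and> g (y x) \<le> 1"
  shows "(\<integral>\<^sup>+x. h (y x) * indicator {x \<in> space M. U x \<le> g (y x)} x \<partial>M) =
         (\<integral>\<^sup>+x. h (y x) * ennreal (g (y x)) \<partial>M)"
proof -
  have [measurable]: "U \<in> borel_measurable M" "y \<in> borel_measurable M"
    using ind by (auto dest: indep_var_rv1 indep_var_rv2)
  interpret V: prob_space "distr M borel U"
    by (rule prob_space_distr) simp
  interpret Y: prob_space "distr M borel y"
    by (rule prob_space_distr) simp
  interpret VY: pair_sigma_finite "distr M borel U" "distr M borel y" ..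
  have unif: "emeasure (distr M borel U) {..c} = ennreal c" if "0 \<le> c" "c \<le> 1" for c
  proof -
    have "{0..1} \<inter> {..c} = {0..c}"
      using that by auto
    then show ?thesis
      unfolding U using that divide_ennreal[of c 1] by simp
  qed
  have "(\<integral>\<^sup>+x. h (y x) * indicator {x \<in> space M. U x \<le> g (y x)} x \<partial>M) =
        (\<integral>\<^sup>+x. (\<lambda>(u, t). h t * indicator {..g t} u) (U x, y x) \<partial>M)"
    by (intro nn_integral_cong) (auto split: split_indicator)
  also have "\<dots> = (\<integral>\<^sup>+z. (\<lambda>(u, t). h t * indicator {..g t} u) z
                    \<partial>distr M (borel \<Otimes>\<^sub>M borel) (\<lambda>x. (U x, y x)))"
    by (subst nn_integral_distr) (auto simp: indicator_def)
  also have "\<dots> = (\<integral>\<^sup>+z. (\<lambda>(u, t). h t * indicator {..g t} u) z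
                    \<partial>(distr M borel U \<Otimes>\<^sub>M distr M borel y))"
    using ind unfolding indep_var_distribution_eq by simp
  also have "\<dots> = (\<integral>\<^sup>+t. \<integral>\<^sup>+u. h t * indicator {..g t} u \<partial>distr M borel U \<partial>distr M borel y)"
    by (subst VY.nn_integral_snd[symmetric]) (auto simp: indicator_def)
  also have "\<dots> = (\<integral>\<^sup>+t. h t * emeasure (distr M borel U) {..g t} \<partial>distr M borel y)"
    by (intro nn_integral_cong) (subst nn_integral_cmult, auto)
  also have "\<dots> = (\<integral>\<^sup>+x. h (y x) * emeasure (distr M borel U) {..g (y x)} \<partial>M)"
  proof (rule nn_integral_distr)
    \<comment> \<open>Measurability in \<open>t\<close> of the inner probability: it is the measure
      of the section at \<open>t\<close> of the region below the graph of \<open>g\<close>.\<close>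
    have "{z \<in> space (borel \<Otimes>\<^sub>M borel). snd z \<le> g (fst z)} \<in> sets (borel \<Otimes>\<^sub>M borel)"
      by measurable
    then have "{z. snd z \<le> g (fst z)} \<in> sets (borel \<Otimes>\<^sub>M distr M borel U)"
      by (simp add: space_pair_measure cong: sets_pair_measure_cong)
    then have "(\<lambda>t. emeasure (distr M borel U) (Pair t -` {z. snd z \<le> g (fst z)}))
        \<in> borel_measurable (borel :: real measure)"
      by (rule V.measurable_emeasure_Pair)
    then show "(\<lambda>t. h t * emeasure (distr M borel U) {..g t}) \<in> borel_measurable (distr M borel y)"
      by (simp add: vimage_def atMost_def)
  qed simp
  also have "\<dots> = (\<integral>\<^sup>+x. h (y x) * ennreal (g (y x)) \<partial>M)"
    using g by (intro nn_integral_cong) (simp add: unif)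
  finally show ?thesis .
qed

lemma (in prob_space) sigma_finite_subalgebra_vimage:
  assumes "a \<in> borel_measurable M"
  shows "sigma_finite_subalgebra M (vimage_algebra (space M) a borel)"
proof -
  have "finite_measure_subalgebra M (vimage_algebra (space M) a borel)"
    using sets_image_in_sets[OF refl assms] by unfold_locales (auto simp: subalgebra_def)
  then show ?thesis
    by (rule finite_measure_subalgebra_is_sigma_finite)
qed

text \<open>
  The level is an injective function of \<open>y\<close>, so conditioning on it is conditioning on \<open>y\<close>; given
  \<open>y\<close>, rejection takes place with probability \<open>y * a\<close>.
\<close>

lemma (in prob_space) level_realizing_cond_exp:
  fixes y :: "'a \<Rightarrow> real"
  assumes ext: "external_randomization M" and y[measurable]: "y \<in> borel_measurable M"
    and yb: "\<And>x. x \<in> space M \<Longrightarrow> 0 \<le> y x \<and> y x \<le> N"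
    and lh: "0 < lo" "lo < hi" "hi < 1" "hi * N \<le> 1" and N: "0 < N"
  obtains a A where "data_dependent_level M a" "\<And>x. x \<in> space M \<Longrightarrow> lo \<le> a x \<and> a x \<le> hi"
    "A \<in> sets M"
    "AE x in M. ennreal (y x) =
       nn_cond_exp M (vimage_algebra (space M) a borel) (\<lambda>x. ennreal (indicator A x / a x)) x"
    "emeasure M A = (\<integral>\<^sup>+x. ennreal (y x * a x) \<partial>M)"
proof -
  obtain U where [measurable]: "U \<in> borel_measurable M"
    and U: "distr M borel U = uniform_measure lborel {0..1}" and ind: "indep_var borel U borel y"
    using independent_uniform[OF ext y] by blast
  \<comment> \<open>The increasing affine map of [0, N] onto [\<open>lo\<close>, \<open>hi\<close>].
    Since \<open>lo < hi\<close> it is injective, so no information about \<open>y\<close> is lost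
    in the level.\<close>
  define l where "l t = lo + (hi - lo) * t / N" for t :: real
  define a where "a x = l (y x)" for x
  define A where "A = {x \<in> space M. U x \<le> y x * l (y x)}"
  have [measurable]: "l \<in> borel_measurable borel"
    unfolding l_def by measurable
  have [measurable]: "a \<in> borel_measurable M" "A \<in> sets M"
    unfolding a_def A_def by measurable
  have ab: "lo \<le> a x \<and> a x \<le> hi" if "x \<in> space M" for x
  proof -
    have "0 \<le> y x / N" "y x / N \<le> 1"
      using yb[OF that] N by auto
    then have "0 \<le> (hi - lo) * (y x / N)" "(hi - lo) * (y x / N) \<le> (hi - lo) * 1"
      using lh mult_nonneg_nonneg[of "hi - lo" "y x / N"] mult_left_mono[of "y x / N" 1 "hi - lo"]
      by linarith+
    then show ?thesis
      by (simp add: a_def l_def)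
  qed
  \<comment> \<open>The conditional rejection probability must lie in [0, 1]; this is what
    \<open>hi * N \<le> 1\<close> provides.\<close>
  have ya: "0 \<le> y x * a x \<and> y x * a x \<le> 1" if "x \<in> space M" for x
  proof -
    have "y x * a x \<le> N * hi"
      using ab[OF that] yb[OF that] lh N by (intro mult_mono) auto
    then show ?thesis
      using ab[OF that] yb[OF that] lh by (auto simp: mult.commute)
  qed
  have key: "(\<integral>\<^sup>+x. h (y x) * indicator A x \<partial>M) = (\<integral>\<^sup>+x. h (y x) * ennreal (y x * a x) \<partial>M)"
    if [measurable]: "h \<in> borel_measurable borel" for h :: "real \<Rightarrow> ennreal"
    using nn_integral_threshold[OF U ind, of "\<lambda>t. t * l t" h] ya
    unfolding A_def a_def by simp
  let ?F = "vimage_algebra (space M) a borel"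
  interpret F: sigma_finite_subalgebra M ?F
    by (rule sigma_finite_subalgebra_vimage) simp
  have "AE x in M. ennreal (y x) = nn_cond_exp M ?F (\<lambda>x. ennreal (indicator A x / a x)) x"
  proof (rule F.nn_cond_exp_charact)
    have [measurable]: "a \<in> borel_measurable ?F"
      by (rule measurable_vimage_algebra1) simp
    \<comment> \<open>The inverse of \<open>l\<close> recovers \<open>y\<close> from the level, so
      \<open>y\<close> is measurable with respect to the sigma-algebra of the level.\<close>
    have "(\<lambda>x. ennreal (N * (a x - lo) / (hi - lo))) \<in> borel_measurable ?F"
      by measurable
    moreover have "N * (a x - lo) / (hi - lo) = y x" for x
      using lh N by (simp add: a_def l_def field_simps)
    ultimately show "(\<lambda>x. ennreal (y x)) \<in> borel_measurable ?F"
      by simp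
  next
    fix D assume "D \<in> sets ?F"
    then obtain B where [measurable]: "B \<in> sets borel" and D: "D = a -` B \<inter> space M"
      by (auto simp: sets_vimage_algebra2)
    \<comment> \<open>Both the factor \<open>1 / a\<close> and the event \<open>D\<close> are
      functions of \<open>y\<close>, so \<open>key\<close> replaces the indicator of
      \<open>A\<close> by \<open>y * a\<close>, and the factor \<open>a\<close> cancels.\<close>
    have "(\<integral>\<^sup>+x\<in>D. ennreal (indicator A x / a x) \<partial>M) =
          (\<integral>\<^sup>+x. (\<lambda>t. ennreal (1 / l t) * indicator B (l t)) (y x) * indicator A x \<partial>M)"
      by (intro nn_integral_cong) (auto simp: D a_def split: split_indicator)
    also have "\<dots> = (\<integral>\<^sup>+x. (\<lambda>t. ennreal (1 / l t) * indicator B (l t)) (y x) * ennreal (y x * a x) \<partial>M)"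
      by (rule key) measurable
    also have "\<dots> = (\<integral>\<^sup>+x\<in>D. ennreal (y x) \<partial>M)"
    proof (intro nn_integral_cong)
      fix x assume x: "x \<in> space M"
      have "ennreal (1 / a x) * ennreal (y x * a x) = ennreal (y x)"
        using ab[OF x] yb[OF x] lh by (subst ennreal_mult'[symmetric]) auto
      then show "(\<lambda>t. ennreal (1 / l t) * indicator B (l t)) (y x) * ennreal (y x * a x) =
          ennreal (y x) * indicator D x"
        using x by (auto simp: D a_def split: split_indicator)
    qed
    finally show "(\<integral>\<^sup>+x\<in>D. ennreal (indicator A x / a x) \<partial>M) = (\<integral>\<^sup>+x\<in>D. ennreal (y x) \<partial>M)" .
  qed simp
  moreover have "emeasure M A = (\<integral>\<^sup>+x. ennreal (y x * a x) \<partial>M)"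
    using key[of "\<lambda>_. 1"] by simp
  moreover have "data_dependent_level M a"
    using ab lh unfolding data_dependent_level_def by force
  ultimately show ?thesis
    using ab by (intro that[of a A]) auto
qed

section \<open>Conditional expectations given the level\<close>

text \<open>A constant level generates the trivial sigma-algebra, so conditioning on it is plain
  integration.\<close>

lemma (in prob_space) nn_cond_exp_const_level:
  assumes [measurable]: "f \<in> borel_measurable M"
  shows "AE x in M. (\<integral>\<^sup>+y. f y \<partial>M) =
           nn_cond_exp M (vimage_algebra (space M) (\<lambda>_. c) (borel :: real measure)) f x"
proof -
  interpret F: sigma_finite_subalgebra M "vimage_algebra (space M) (\<lambda>_. c) (borel :: real measure)"
    by (rule sigma_finite_subalgebra_vimage) simp
  show ?thesis
  proof (rule F.nn_cond_exp_charact)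
    fix D assume "D \<in> sets (vimage_algebra (space M) (\<lambda>_. c) (borel :: real measure))"
    then have "D = {} \<or> D = space M"
      by (auto simp: sets_vimage_algebra2 split: if_splits)
    then show "(\<integral>\<^sup>+x\<in>D. f x \<partial>M) = (\<integral>\<^sup>+x\<in>D. (\<integral>\<^sup>+y. f y \<partial>M) \<partial>M)"
    proof
      assume "D = space M"
      then show ?thesis
        by (simp add: emeasure_space_1 cong: nn_integral_cong_simp)
    qed simp
  qed auto
qed

text \<open>Linearity is used only for nonnegative functions: the positive part \<open>p\<close> and
  negative part \<open>q\<close> of \<open>l + k * g\<close> are linked by an identity between sums
  of nonnegative terms, to which conditional expectation applies termwise. The subtraction is done
  only at the end.\<close>

lemma (in sigma_finite_subalgebra) gen_cond_exp_affine:
  fixes g :: "'a \<Rightarrow> real"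
  assumes [measurable]: "g \<in> borel_measurable M" and g: "\<And>x. x \<in> space M \<Longrightarrow> 0 \<le> g x" and "0 \<le> k"
  shows "AE x in M. gen_cond_exp M F (\<lambda>x. l + k * g x) x =
           ereal l + ereal k * enn2ereal (nn_cond_exp M F (\<lambda>x. ennreal (g x)) x)"
proof -
  \<comment> \<open>\<open>P\<close> and \<open>E\<close> may be infinite; the rearrangement is
    legitimate because \<open>r\<close> and both parts of \<open>l\<close> are finite.\<close>
  have cancel: "P - ereal r = ereal l + E"
    if "P + ereal (max 0 (- l)) = ereal r + ereal (max 0 l) + E" "0 \<le> E" for P E :: ereal and r
    using that by (cases P; cases E) (auto simp: max_def split: if_splits)
  define p where "p x = ennreal (l + k * g x)" for x
  define q where "q x = ennreal (- (l + k * g x))" for x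
  have [measurable]: "p \<in> borel_measurable M" "q \<in> borel_measurable M"
    unfolding p_def q_def by measurable
  let ?E = "nn_cond_exp M F"
  have const: "AE x in M. c = ?E (\<lambda>_. c) x" for c :: ennreal
    by (rule nn_cond_exp_F_meas) simp
  have "p x + ennreal (- l) = q x + ennreal l + ennreal k * ennreal (g x)" if "x \<in> space M" for x
  proof -
    have kg: "0 \<le> k * g x"
      using g[OF that] assms by simp
    have "ennreal (l + t) + ennreal (- l) = ennreal (- (l + t)) + ennreal l + ennreal t"
      if "0 \<le> t" for t
      using that by (cases "0 \<le> l"; cases "0 \<le> l + t") (simp_all add: ennreal_neg flip: ennreal_plus)
    from this[OF kg] show ?thesis
      using assms g[OF that] by (simp add: p_def q_def ennreal_mult)
  qed
  then have "AE x in M. ?E (\<lambda>x. p x + ennreal (- l)) x =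
      ?E (\<lambda>x. q x + ennreal l + ennreal k * ennreal (g x)) x"
    by (intro nn_cond_exp_cong) auto
  moreover have "AE x in M. ?E p x + ?E (\<lambda>_. ennreal (- l)) x = ?E (\<lambda>x. p x + ennreal (- l)) x"
    by (rule nn_cond_exp_sum) auto
  moreover have "AE x in M. ?E q x + ?E (\<lambda>_. ennreal l) x = ?E (\<lambda>x. q x + ennreal l) x"
    by (rule nn_cond_exp_sum) auto
  moreover have "AE x in M. ?E (\<lambda>x. q x + ennreal l) x + ?E (\<lambda>x. ennreal k * ennreal (g x)) x =
      ?E (\<lambda>x. q x + ennreal l + ennreal k * ennreal (g x)) x"
    by (rule nn_cond_exp_sum) auto
  moreover have "AE x in M. ennreal k * ?E (\<lambda>x. ennreal (g x)) x =
      ?E (\<lambda>x. ennreal k * ennreal (g x)) x"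
    by (rule nn_cond_exp_prod) auto
  \<comment> \<open>As \<open>k * g\<close> is nonnegative, the negative part is at most that of
    \<open>l\<close>; hence the subtrahend is almost surely finite.\<close>
  moreover have "AE x in M. ?E q x \<le> ?E (\<lambda>_. ennreal (- l)) x"
    using assms(2,3) by (intro nn_cond_exp_mono) (auto simp: q_def intro!: ennreal_leI)
  moreover note const[of "ennreal l"] const[of "ennreal (- l)"]
  ultimately show ?thesis
  proof eventually_elim
    case (elim x)
    let ?P = "?E p x" and ?Q = "?E q x" and ?G = "?E (\<lambda>x. ennreal (g x)) x"
    have eq: "?P + ennreal (- l) = ?Q + ennreal l + ennreal k * ?G" and le: "?Q \<le> ennreal (- l)"
      using elim by simp_all
    obtain r where r: "?Q = ennreal r" "0 \<le> r"
      using le by (cases ?Q) (auto simp: top_unique)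
    have l: "enn2ereal (ennreal t) = ereal (max 0 t)" for t
      by (simp add: max_def ennreal_neg zero_ennreal.rep_eq)
    have "enn2ereal ?P + ereal (max 0 (- l)) = ereal r + ereal (max 0 l) + ereal k * enn2ereal ?G"
      using arg_cong[OF eq, of enn2ereal] r \<open>0 \<le> k\<close>
      by (simp add: plus_ennreal.rep_eq times_ennreal.rep_eq l)
    moreover have "gen_cond_exp M F (\<lambda>x. l + k * g x) x = enn2ereal ?P - ereal r"
      using r unfolding gen_cond_exp_def p_def q_def by simp
    moreover have "0 \<le> enn2ereal ?P" "0 \<le> enn2ereal ?G"
      by simp_all
    ultimately show ?case
      using cancel[of "enn2ereal ?P" r "ereal k * enn2ereal ?G"] \<open>0 \<le> k\<close> by simp
  qed
qed

section \<open>Validity in terms of the normalized conditional loss\<close>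

locale certainty_equivalent_validity = prob_space M for M :: "'a measure" +
  fixes d :: "real \<Rightarrow> 'd::{linorder, order_bot}"
    and L :: "'d \<Rightarrow> real"
    and C :: real
    and \<rho> :: "('a \<Rightarrow> ereal) \<Rightarrow> ereal"
  assumes ext: "external_randomization M"
    and levels: "evidence_levels d"
    and L_mono: "mono L"
    and C: "L bot < C"
    and ce: "certainty_equivalent M (ereal (L bot)) \<rho>"
    and cont: "continuous_from_below M (ereal (L bot)) \<rho>"
    and nests: "nests_classical M d (valid_for M \<rho> L C)"
    and preserves: "preserves_classical M d L (valid_for M \<rho> L C)"
    and monotone: "monotone_validity M d L (valid_for M \<rho> L C)"
begin

abbreviation nl :: "'d \<Rightarrow> real" where
  "nl \<equiv> normalized_loss L C"

text \<open>The inverse of the normalization, extended to infinite values, so that normalized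
  conditional losses can be handled as functions into \<open>ennreal\<close>.\<close>

definition loss :: "ennreal \<Rightarrow> ereal" where
  "loss v = ereal (L bot) + ereal (C - L bot) * enn2ereal v"

definition acceptable :: "('a \<Rightarrow> ennreal) \<Rightarrow> bool" where
  "acceptable V \<longleftrightarrow> \<rho> (\<lambda>x. loss (V x)) \<le> ereal C"

lemma L_eq: "L v = L bot + (C - L bot) * nl v"
  using C by (simp add: normalized_loss_def)

lemma nl_nonneg: "0 \<le> nl v"
  using C L_mono by (simp add: normalized_loss_def monoD)

lemma nl_mono: "v \<le> w \<Longrightarrow> nl v \<le> nl w"
  using C L_mono by (auto simp: normalized_loss_def monoD intro!: divide_right_mono)

lemma nl_bot [simp]: "nl bot = 0"
  by (simp add: normalized_loss_def)

lemma loss_mem [simp]: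
  assumes [measurable]: "V \<in> borel_measurable M"
  shows "(\<lambda>x. loss (V x)) \<in> rv_ge M (ereal (L bot))"
proof -
  have "ereal (L bot) \<le> loss v" for v
    using C by (auto simp: loss_def ereal_le_add_self)
  moreover have "(\<lambda>x. loss (V x)) \<in> borel_measurable M"
    unfolding loss_def by measurable
  ultimately show ?thesis
    by (simp add: rv_ge_def)
qed

lemma certainty_equivalent_cong:
  assumes "X \<in> rv_ge M (ereal (L bot))" "Y \<in> rv_ge M (ereal (L bot))" "AE x in M. X x = Y x"
  shows "\<rho> X = \<rho> Y"
  using ce assms unfolding certainty_equivalent_def by blast

lemma acceptable_cong:
  assumes "V \<in> borel_measurable M" "W \<in> borel_measurable M" "AE x in M. V x = W x"
  shows "acceptable V \<longleftrightarrow> acceptable W"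
proof -
  have "AE x in M. loss (V x) = loss (W x)"
    using assms(3) by eventually_elim simp
  then have "\<rho> (\<lambda>x. loss (V x)) = \<rho> (\<lambda>x. loss (W x))"
    using assms(1,2) by (intro certainty_equivalent_cong) simp_all
  then show ?thesis
    by (simp add: acceptable_def)
qed

lemma acceptable_const:
  assumes "0 \<le> c"
  shows "acceptable (\<lambda>_. ennreal c) \<longleftrightarrow> c \<le> 1"
proof -
  have "loss (ennreal c) = ereal (L bot + (C - L bot) * c)"
    using assms by (simp add: loss_def)
  moreover have "ereal (L bot) \<le> ereal (L bot + (C - L bot) * c)"
    using assms C by simp
  ultimately have "\<rho> (\<lambda>_. loss (ennreal c)) = ereal (L bot + (C - L bot) * c)"
    using ce unfolding certainty_equivalent_def by metis
  moreover have "L bot + (C - L bot) * c \<le> C \<longleftrightarrow> (C - L bot) * c \<le> (C - L bot) * 1"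
    by (simp add: algebra_simps)
  ultimately show ?thesis
    using C unfolding acceptable_def by simp
qed

text \<open>Along an increasing sequence the values of \<open>\<rho>\<close> increase to the value
  at the limit. The bound \<open>C\<close> therefore passes to the limit, and from the limit down to
  every member.\<close>

lemma
  assumes Z: "\<And>n. Z n \<in> borel_measurable M" and V: "V \<in> borel_measurable M"
    and inc: "\<And>x. x \<in> space M \<Longrightarrow> incseq (\<lambda>n. Z n x)"
    and lim: "\<And>x. x \<in> space M \<Longrightarrow> (\<lambda>n. Z n x) \<longlonglongrightarrow> V x"
  shows acceptable_lim: "(\<And>n. acceptable (Z n)) \<Longrightarrow> acceptable V"
    and acceptable_below: "acceptable V \<Longrightarrow> acceptable (Z n)"
proof -
  have "AE x in M. incseq (\<lambda>n. loss (Z n x)) \<and> (\<lambda>n. loss (Z n x)) \<longlonglongrightarrow> loss (V x)"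
  proof (intro AE_I2 conjI)
    fix x assume x: "x \<in> space M"
    show "incseq (\<lambda>n. loss (Z n x))"
      using inc[OF x] C unfolding loss_def incseq_def
      by (auto intro!: add_left_mono ereal_mult_left_mono simp: less_eq_ennreal.rep_eq)
    show "(\<lambda>n. loss (Z n x)) \<longlonglongrightarrow> loss (V x)"
      using lim[OF x] unfolding loss_def add.commute[of "ereal (L bot)"]
      by (intro tendsto_add_left_ereal tendsto_cmult_ereal) auto
  qed
  then have *: "incseq (\<lambda>n. \<rho> (\<lambda>x. loss (Z n x)))"
    "(\<lambda>n. \<rho> (\<lambda>x. loss (Z n x))) \<longlonglongrightarrow> \<rho> (\<lambda>x. loss (V x))"
    using cont[unfolded continuous_from_below_def, rule_format,
        of "\<lambda>x. loss (V x)" "\<lambda>n x. loss (Z n x)"] Z V by auto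
  show "acceptable V" if "\<And>n. acceptable (Z n)"
    using LIMSEQ_le_const2[OF *(2)] that unfolding acceptable_def by blast
  show "acceptable (Z n)" if "acceptable V"
    using incseq_le[OF *, of n] that unfolding acceptable_def by order
qed

text \<open>Monotonicity comes out of continuity from below: the sequence V, W, W, ... increases to
  W, and V is its first member.\<close>

lemma acceptable_mono:
  assumes "acceptable W" "V \<in> borel_measurable M" "W \<in> borel_measurable M"
    and "\<And>x. x \<in> space M \<Longrightarrow> V x \<le> W x"
  shows "acceptable V"
proof -
  let ?Z = "\<lambda>n x. if n = (0::nat) then V x else W x"
  have "acceptable (?Z 0)"
  proof (rule acceptable_below[where Z = ?Z and V = W])
    show "(\<lambda>n. ?Z n x) \<longlonglongrightarrow> W x" for x
      by (rule tendsto_eventually) (auto simp: eventually_sequentially intro: exI[of _ 1])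
    show "?Z n \<in> borel_measurable M" for n
      using assms(2,3) by (cases n) simp_all
  qed (use assms in \<open>auto simp: incseq_def\<close>)
  then show ?thesis
    by simp
qed

text \<open>Normalization commutes with conditional expectation up to a null set, and
  \<open>\<rho>\<close> ignores null sets.\<close>

lemma valid_iff_acceptable:
  assumes [measurable]: "a \<in> borel_measurable M"
    and Lm: "(\<lambda>x. L (test_at \<phi> a x)) \<in> borel_measurable M"
  shows "valid_for M \<rho> L C \<phi> a \<longleftrightarrow>
    acceptable (nn_cond_exp M (vimage_algebra (space M) a borel)
      (\<lambda>x. ennreal (nl (test_at \<phi> a x))))"
proof -
  let ?F = "vimage_algebra (space M) a borel"
  interpret F: sigma_finite_subalgebra M ?F
    by (rule sigma_finite_subalgebra_vimage) simp
  let ?f = "\<lambda>x. nl (test_at \<phi> a x)"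
  let ?V = "\<lambda>x. loss (nn_cond_exp M ?F (\<lambda>x. ennreal (?f x)) x)"
  have [measurable]: "?f \<in> borel_measurable M"
    using Lm unfolding normalized_loss_def by measurable
  have "(\<lambda>x. L (test_at \<phi> a x)) = (\<lambda>x. L bot + (C - L bot) * ?f x)"
    using L_eq by blast
  then have ae: "AE x in M. gen_cond_exp M ?F (\<lambda>x. L (test_at \<phi> a x)) x = ?V x"
    using F.gen_cond_exp_affine[of ?f "C - L bot" "L bot"] C nl_nonneg by (simp add: loss_def)
  have V: "?V \<in> rv_ge M (ereal (L bot))"
    by simp
  have "gen_cond_exp M ?F (\<lambda>x. L (test_at \<phi> a x)) \<in> borel_measurable M"
    unfolding gen_cond_exp_def by measurable
  moreover have "AE x in M. ereal (L bot) \<le> gen_cond_exp M ?F (\<lambda>x. L (test_at \<phi> a x)) x"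
    using ae V[unfolded rv_ge_def] by auto
  ultimately have "gen_cond_exp M ?F (\<lambda>x. L (test_at \<phi> a x)) \<in> rv_ge M (ereal (L bot))"
    by (simp add: rv_ge_def)
  then have "\<rho> (gen_cond_exp M ?F (\<lambda>x. L (test_at \<phi> a x))) = \<rho> ?V"
    using V ae by (rule certainty_equivalent_cong)
  then show ?thesis
    by (simp add: valid_for_def acceptable_def)
qed

section \<open>Tests rejecting on one event, and the loss of a rejection\<close>

text \<open>The event is the same at all levels and only the strength of the rejection varies, so
  the evidence at two levels can be compared pointwise.\<close>

definition reject_on :: "'a set \<Rightarrow> real \<Rightarrow> 'a \<Rightarrow> 'd" where
  "reject_on A \<alpha> x = (if x \<in> A then d \<alpha> else bot)"

lemma test_family_reject_on: "A \<in> sets M \<Longrightarrow> test_family M d (reject_on A)"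
proof -
  assume A: "A \<in> sets M"
  \<comment> \<open>The degenerate case \<open>d \<alpha> = bot\<close>, where every outcome counts
    as a rejection, is excluded only later, by nesting.\<close>
  have "{x \<in> space M. reject_on A \<alpha> x = d \<alpha>} = (if d \<alpha> = bot then space M else A)" for \<alpha>
    using sets.sets_into_space[OF A] by (auto simp: reject_on_def)
  then show ?thesis
    using A by (auto simp: test_family_def reject_on_def)
qed

lemma uniform_threshold_event:
  assumes "0 \<le> c" "c \<le> 1"
  obtains A where "A \<in> sets M" "emeasure M A = ennreal c"
proof -
  obtain U :: "'a \<Rightarrow> real" where [measurable]: "U \<in> borel_measurable M"
    and U: "distr M borel U = uniform_measure lborel {0..1}" and ind: "indep_var borel U borel (\<lambda>_. 0)"
    using independent_uniform[OF ext, of "\<lambda>_. 0"] by auto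
  have "emeasure M {x \<in> space M. U x \<le> c} = ennreal c"
    using nn_integral_threshold[OF U ind, of "\<lambda>_. c" "\<lambda>_. 1"] assms
    by (simp add: emeasure_space_1)
  then show ?thesis
    by (intro that[of "{x \<in> space M. U x \<le> c}"]) auto
qed

text \<open>The conditional loss is here the constant \<open>nl (d \<alpha>) * c\<close>, and
  \<open>\<rho>\<close> fixes constants.\<close>

lemma valid_const_level_iff:
  assumes \<alpha>: "\<alpha> \<in> {0<..<1}" and [measurable]: "A \<in> sets M" and c: "emeasure M A = ennreal c" "0 \<le> c"
  shows "valid_for M \<rho> L C (reject_on A) (\<lambda>_. \<alpha>) \<longleftrightarrow> nl (d \<alpha>) * c \<le> 1"
proof -
  let ?f = "\<lambda>x. ennreal (nl (test_at (reject_on A) (\<lambda>_. \<alpha>) x))"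
  have L: "(\<lambda>x. L (test_at (reject_on A) (\<lambda>_. \<alpha>) x)) \<in> borel_measurable M"
    unfolding test_at_def reject_on_def if_distrib[of L] by measurable
  then have [measurable]: "?f \<in> borel_measurable M"
    unfolding normalized_loss_def by measurable
  have "(\<integral>\<^sup>+x. ?f x \<partial>M) = (\<integral>\<^sup>+x. ennreal (nl (d \<alpha>)) * indicator A x \<partial>M)"
    by (intro nn_integral_cong) (auto simp: test_at_def reject_on_def)
  also have "\<dots> = ennreal (nl (d \<alpha>) * c)"
    using c by (simp add: nn_integral_cmult nl_nonneg ennreal_mult)
  finally have int: "(\<integral>\<^sup>+x. ?f x \<partial>M) = ennreal (nl (d \<alpha>) * c)" .
  interpret F: sigma_finite_subalgebra M "vimage_algebra (space M) (\<lambda>_. \<alpha>) borel"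
    by (rule sigma_finite_subalgebra_vimage) simp
  have "valid_for M \<rho> L C (reject_on A) (\<lambda>_. \<alpha>) \<longleftrightarrow> acceptable (\<lambda>_. ennreal (nl (d \<alpha>) * c))"
    unfolding valid_iff_acceptable[OF _ L, simplified]
    using nn_cond_exp_const_level[of ?f \<alpha>] int by (intro acceptable_cong) auto
  then show ?thesis
    using c nl_nonneg by (simp add: acceptable_const)
qed

text \<open>Nesting makes validity at the constant level \<open>\<alpha>\<close> the condition P(A)
  \<le> \<alpha>, whereas the loss makes it \<open>nl (d \<alpha>)\<close> P(A) \<le> 1. Events of
  every probability exist, so the two thresholds coincide.\<close>

lemma
  assumes \<alpha>: "\<alpha> \<in> {0<..<1}"
  shows d_neq_bot: "d \<alpha> \<noteq> bot" and nl_d: "nl (d \<alpha>) = 1 / \<alpha>"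
proof -
  have iff: "valid_for M \<rho> L C (reject_on A) (\<lambda>_. \<alpha>) \<longleftrightarrow>
      measure M {x \<in> space M. reject_on A \<alpha> x = d \<alpha>} \<le> \<alpha>" if "A \<in> sets M" for A
    using nests \<alpha> test_family_reject_on[OF that]
    unfolding nests_classical_def classically_valid_def by blast
  show *: "d \<alpha> \<noteq> bot"
  proof
    \<comment> \<open>The empty event has zero loss and is valid, yet rejection would then have
      probability 1, which exceeds \<open>\<alpha>\<close>.\<close>
    assume "d \<alpha> = bot"
    then have "valid_for M \<rho> L C (reject_on {}) (\<lambda>_. \<alpha>)"
      and "{x \<in> space M. reject_on {} \<alpha> x = d \<alpha>} = space M"
      using valid_const_level_iff[OF \<alpha>, of "{}" 0] by (auto simp: reject_on_def)
    then show False
      using iff[of "{}"] \<alpha> by (simp add: prob_space)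
  qed
  have eq: "nl (d \<alpha>) * c \<le> 1 \<longleftrightarrow> c \<le> \<alpha>" if c: "0 \<le> c" "c \<le> 1" for c
  proof -
    obtain A where A: "A \<in> sets M" "emeasure M A = ennreal c"
      using uniform_threshold_event[OF c] .
    have "{x \<in> space M. reject_on A \<alpha> x = d \<alpha>} = A"
      using * sets.sets_into_space[OF A(1)] by (auto simp: reject_on_def)
    moreover have "measure M A = c"
      using A that by (simp add: measure_def)
    ultimately show ?thesis
      using iff[OF A(1)] valid_const_level_iff[OF \<alpha> A] that by simp
  qed
  have "nl (d \<alpha>) \<le> 1 / \<alpha>"
    using eq[of \<alpha>] \<alpha> by (simp add: field_simps)
  moreover have "1 / \<alpha> \<le> nl (d \<alpha>)"
  proof (rule ccontr)
    assume "\<not> 1 / \<alpha> \<le> nl (d \<alpha>)"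
    then have less: "nl (d \<alpha>) * \<alpha> < 1"
      using \<alpha> by (simp add: field_simps)
    \<comment> \<open>Probability 1 violates the level, so \<open>n > 1\<close> and
      \<open>1 / n\<close> is itself a probability; it is accepted by the loss although it exceeds
      \<open>\<alpha>\<close>.\<close>
    define n where "n = nl (d \<alpha>)"
    have n: "1 < n"
      using eq[of 1] \<alpha> by (simp add: n_def)
    then have "\<alpha> < 1 / n"
      using less by (simp add: n_def field_simps)
    then show False
      using eq[of "1 / n"] n by (simp add: n_def)
  qed
  ultimately show "nl (d \<alpha>) = 1 / \<alpha>"
    by simp
qed

text \<open>The loss \<open>1 / \<alpha>\<close> separates the levels, which makes the antitone map
  \<open>d\<close> strictly so.\<close>

lemma d_le_iff:
  assumes "\<alpha> \<in> {0<..<1}" "\<beta> \<in> {0<..<1}"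
  shows "d \<alpha> \<le> d \<beta> \<longleftrightarrow> \<beta> \<le> \<alpha>"
proof
  assume "d \<alpha> \<le> d \<beta>"
  then show "\<beta> \<le> \<alpha>"
    using nl_mono[of "d \<alpha>" "d \<beta>"] assms by (simp add: nl_d field_simps)
next
  assume "\<beta> \<le> \<alpha>"
  then show "d \<alpha> \<le> d \<beta>"
    using levels assms unfolding evidence_levels_def monotone_on_def by blast
qed

context
  fixes A :: "'a set" and a :: "'a \<Rightarrow> real"
  assumes A[measurable]: "A \<in> sets M" and a: "data_dependent_level M a"
begin

lemma nl_test_at_reject_on:
  "x \<in> space M \<Longrightarrow> nl (test_at (reject_on A) a x) = indicator A x / a x"
  using a by (auto simp: test_at_def reject_on_def nl_d data_dependent_level_def)

lemma reject_on_exceeds: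
  assumes "\<alpha> \<in> {0<..<1}"
  shows "{x \<in> space M. d \<alpha> \<le> test_at (reject_on A) a x} = {x \<in> A. a x \<le> \<alpha>}"
proof -
  have "d \<alpha> \<le> test_at (reject_on A) a x \<longleftrightarrow> x \<in> A \<and> a x \<le> \<alpha>" if "x \<in> space M" for x
    using a that assms
    by (auto simp: data_dependent_level_def test_at_def reject_on_def d_le_iff d_neq_bot bot_unique)
  then show ?thesis
    using sets.sets_into_space[OF A] by auto
qed

lemma admissible_reject_on: "admissible M d L (reject_on A) a"
proof -
  have [measurable]: "a \<in> borel_measurable M"
    using a by (simp add: data_dependent_level_def)
  have "(\<lambda>x. L bot + (C - L bot) * (indicator A x / a x)) \<in> borel_measurable M"
    by measurable
  then have "(\<lambda>x. L (test_at (reject_on A) a x)) \<in> borel_measurable M"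
    by (rule measurable_cong[THEN iffD1, rotated])
      (simp add: nl_test_at_reject_on[symmetric] flip: L_eq)
  moreover have "{x \<in> A. a x \<le> \<alpha>} \<in> sets M" for \<alpha>
  proof -
    have "{x \<in> A. a x \<le> \<alpha>} = A \<inter> {x \<in> space M. a x \<le> \<alpha>}"
      using sets.sets_into_space[OF A] by auto
    then show ?thesis
      by simp
  qed
  ultimately show ?thesis
    using a test_family_reject_on[OF A] by (auto simp: admissible_def reject_on_exceeds)
qed

text \<open>Any version \<open>V\<close> of the conditional loss may be used, in particular the
  function \<open>y\<close> realized by randomization.\<close>

lemma valid_reject_on_iff:
  assumes [measurable]: "V \<in> borel_measurable M"
    and V: "AE x in M. V x = nn_cond_exp M (vimage_algebra (space M) a borel)
                               (\<lambda>x. ennreal (indicator A x / a x)) x"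
  shows "valid_for M \<rho> L C (reject_on A) a \<longleftrightarrow> acceptable V"
proof -
  have am[measurable]: "a \<in> borel_measurable M"
    using a by (simp add: data_dependent_level_def)
  interpret F: sigma_finite_subalgebra M "vimage_algebra (space M) a borel"
    by (rule sigma_finite_subalgebra_vimage) simp
  have L: "(\<lambda>x. L (test_at (reject_on A) a x)) \<in> borel_measurable M"
    using admissible_reject_on by (simp add: admissible_def)
  have [measurable]: "(\<lambda>x. nl (test_at (reject_on A) a x)) \<in> borel_measurable M"
    using L unfolding normalized_loss_def by measurable
  have "AE x in M. nn_cond_exp M (vimage_algebra (space M) a borel)
      (\<lambda>x. ennreal (nl (test_at (reject_on A) a x))) x =
    nn_cond_exp M (vimage_algebra (space M) a borel) (\<lambda>x. ennreal (indicator A x / a x)) x"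
    by (intro F.nn_cond_exp_cong) (auto simp: nl_test_at_reject_on)
  then show ?thesis
    unfolding valid_iff_acceptable[OF am L] using V by (intro acceptable_cong) auto
qed

end

section \<open>Bounded conditional losses\<close>

lemma nn_integral_le_1_if_acceptable_bounded:
  fixes y :: "'a \<Rightarrow> real"
  assumes y[measurable]: "y \<in> borel_measurable M" and yb: "\<And>x. x \<in> space M \<Longrightarrow> 0 \<le> y x \<and> y x \<le> N"
    and N: "1 < N" and acc: "acceptable (\<lambda>x. ennreal (y x))"
  shows "(\<integral>\<^sup>+x. ennreal (y x) \<partial>M) \<le> 1"
proof -
  \<comment> \<open>The largest level for which \<open>y * hi\<close> is still a
    probability.\<close>
  define hi where "hi = 1 / N"
  have hi: "0 < hi" "hi < 1" "hi * N \<le> 1" "0 < N"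
    using N by (auto simp: hi_def)
  have bound: "ennreal c * (\<integral>\<^sup>+x. ennreal (y x) \<partial>M) \<le> 1" if c: "0 < c" "c < 1" for c
  proof -
    have lo: "0 < c * hi" "c * hi < hi"
      using hi c by auto
    obtain a A where a: "data_dependent_level M a"
      and ab: "\<And>x. x \<in> space M \<Longrightarrow> c * hi \<le> a x \<and> a x \<le> hi"
      and A: "A \<in> sets M"
      and V: "AE x in M. ennreal (y x) =
        nn_cond_exp M (vimage_algebra (space M) a borel) (\<lambda>x. ennreal (indicator A x / a x)) x"
      and PA: "emeasure M A = (\<integral>\<^sup>+x. ennreal (y x * a x) \<partial>M)"
      by (rule level_realizing_cond_exp[OF ext y yb lo hi(2-4)]) blast+
    have "valid_for M \<rho> L C (reject_on A) a"
      using valid_reject_on_iff[OF A a _ V] acc by simp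
    then have "measure M {x \<in> space M. d hi \<le> test_at (reject_on A) a x} \<le> hi"
      using preserves admissible_reject_on[OF A a] hi unfolding preserves_classical_def by auto
    \<comment> \<open>Every rejection happens at a level at most \<open>hi\<close>, so it counts in
      full at level \<open>hi\<close>.\<close>
    moreover have "{x \<in> space M. d hi \<le> test_at (reject_on A) a x} = A"
      using reject_on_exceeds[OF A a, of hi] hi ab sets.sets_into_space[OF A] by auto
    ultimately have "emeasure M A \<le> ennreal hi"
      by (simp add: emeasure_eq_measure ennreal_leI)
    moreover have "ennreal hi * (ennreal c * (\<integral>\<^sup>+x. ennreal (y x) \<partial>M)) =
        (\<integral>\<^sup>+x. ennreal (y x * (c * hi)) \<partial>M)"
      using hi c yb
      by (simp add: nn_integral_cmult[symmetric] ennreal_mult[symmetric] mult_ac cong: nn_integral_cong_simp)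
    \<comment> \<open>The lower end of the interval enters here: levels of at least
      \<open>c * hi\<close> bound P(A) = E[y a] from below.\<close>
    moreover have "(\<integral>\<^sup>+x. ennreal (y x * (c * hi)) \<partial>M) \<le> emeasure M A"
      unfolding PA using ab yb by (intro nn_integral_mono ennreal_leI mult_left_mono) auto
    ultimately have "ennreal hi * (ennreal c * (\<integral>\<^sup>+x. ennreal (y x) \<partial>M)) \<le> ennreal hi * 1"
      by simp
    then show ?thesis
      using hi by (subst (asm) ennreal_mult_le_mult_iff) auto
  qed
  \<comment> \<open>Boundedness makes the expectation a real \<open>r\<close>, and
    \<open>c * r \<le> 1\<close> for all c < 1 then gives r \<le> 1.\<close>
  have "(\<integral>\<^sup>+x. ennreal (y x) \<partial>M) \<le> (\<integral>\<^sup>+x. ennreal N \<partial>M)"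
    using yb by (intro nn_integral_mono ennreal_leI) auto
  then obtain r where r: "(\<integral>\<^sup>+x. ennreal (y x) \<partial>M) = ennreal r" "0 \<le> r"
    by (cases "\<integral>\<^sup>+x. ennreal (y x) \<partial>M") (auto simp: emeasure_space_1 top_unique)
  have "c * r \<le> 1" if "0 < c" "c < 1" for c
    using bound[OF that] r that by (simp add: ennreal_mult[symmetric] flip: ennreal_1)
  then have "r \<le> 1"
    by (rule field_le_mult_one_interval)
  then show ?thesis
    using r by simp
qed

text \<open>The slack \<open>c\<close> in the expectation doubles as the ratio of the ends of the
  level interval: P(A) is at most \<open>hi\<close> times the expectation, hence at most the lowest
  level \<open>c * hi\<close>.\<close>

lemma acceptable_bounded_if_nn_integral_less:
  fixes y :: "'a \<Rightarrow> real"
  assumes y[measurable]: "y \<in> borel_measurable M" and yb: "\<And>x. x \<in> space M \<Longrightarrow> 0 \<le> y x \<and> y x \<le> N"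
    and N: "1 < N" and c: "0 < c" "c < 1" and int: "(\<integral>\<^sup>+x. ennreal (y x) \<partial>M) \<le> ennreal c"
  shows "acceptable (\<lambda>x. ennreal (y x))"
proof -
  define hi where "hi = 1 / N"
  have hi: "0 < hi" "hi < 1" "hi * N \<le> 1" "0 < N"
    using N by (auto simp: hi_def)
  have lo: "0 < c * hi" "c * hi < hi"
    using hi c by auto
  obtain a A where a: "data_dependent_level M a"
    and ab: "\<And>x. x \<in> space M \<Longrightarrow> c * hi \<le> a x \<and> a x \<le> hi"
    and A: "A \<in> sets M"
    and V: "AE x in M. ennreal (y x) =
      nn_cond_exp M (vimage_algebra (space M) a borel) (\<lambda>x. ennreal (indicator A x / a x)) x"
    and PA: "emeasure M A = (\<integral>\<^sup>+x. ennreal (y x * a x) \<partial>M)"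
    by (rule level_realizing_cond_exp[OF ext y yb lo hi(2-4)]) blast+
  define \<alpha> where "\<alpha> = c * hi"
  have \<alpha>: "\<alpha> \<in> {0<..<1}"
    using lo(1) less_trans[OF lo(2) hi(2)] by (simp add: \<alpha>_def)
  have level: "data_dependent_level M (\<lambda>_. \<alpha>)"
    using \<alpha> by (simp add: data_dependent_level_def)
  have "emeasure M A \<le> (\<integral>\<^sup>+x. ennreal hi * ennreal (y x) \<partial>M)"
    unfolding PA using ab yb hi
    by (intro nn_integral_mono) (auto simp: ennreal_mult[symmetric] mult.commute intro!: ennreal_leI mult_right_mono)
  also have "\<dots> \<le> ennreal hi * ennreal c"
    using int by (simp add: nn_integral_cmult mult_left_mono)
  also have "\<dots> = ennreal \<alpha>"
    using hi c by (simp add: \<alpha>_def ennreal_mult[symmetric] mult.commute)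
  finally have "measure M A \<le> \<alpha>"
    using \<alpha> by (simp add: emeasure_eq_measure)
  moreover have "{x \<in> space M. reject_on A \<alpha> x = d \<alpha>} = A"
    using d_neq_bot[OF \<alpha>] sets.sets_into_space[OF A] by (auto simp: reject_on_def)
  ultimately have "valid_for M \<rho> L C (reject_on A) (\<lambda>_. \<alpha>)"
    using nests \<alpha> test_family_reject_on[OF A]
    unfolding nests_classical_def classically_valid_def by auto
  \<comment> \<open>As \<open>\<alpha>\<close> is the lower end of the range allowed for
    \<open>a\<close>, rejecting at \<open>a\<close> is no stronger than rejecting at
    \<open>\<alpha>\<close>.\<close>
  moreover have "test_at (reject_on A) a x \<le> test_at (reject_on A) (\<lambda>_. \<alpha>) x" if "x \<in> space M" for x
  proof -
    have "a x \<in> {0<..<1}"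
      using a that by (simp add: data_dependent_level_def)
    then show ?thesis
      using ab[OF that] \<alpha> by (simp add: test_at_def reject_on_def d_le_iff \<alpha>_def)
  qed
  ultimately have "valid_for M \<rho> L C (reject_on A) a"
    using monotone admissible_reject_on[OF A a] admissible_reject_on[OF A level]
    unfolding monotone_validity_def by blast
  then show ?thesis
    using valid_reject_on_iff[OF A a _ V] by simp
qed

lemma acceptable_bounded:
  fixes y :: "'a \<Rightarrow> real"
  assumes [measurable]: "y \<in> borel_measurable M" and yb: "\<And>x. x \<in> space M \<Longrightarrow> 0 \<le> y x \<and> y x \<le> N"
    and N: "1 < N" and int: "(\<integral>\<^sup>+x. ennreal (y x) \<partial>M) \<le> 1"
  shows "acceptable (\<lambda>x. ennreal (y x))"
proof -
  \<comment> \<open>Scaling by \<open>c n\<close> creates the required slack and is undone in the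
    limit; the 2 keeps \<open>c 0\<close> positive.\<close>
  define c where "c n = 1 - 1 / (real n + 2)" for n
  have c: "0 < c n" "c n < 1" for n
    by (auto simp: c_def field_simps)
  have c_mono: "c m \<le> c n" if "m \<le> n" for m n
    using that by (auto simp: c_def intro!: divide_left_mono)
  have c_lim: "c \<longlonglongrightarrow> 1"
    unfolding c_def by real_asymp
  show ?thesis
  proof (rule acceptable_lim[where Z = "\<lambda>n x. ennreal (c n * y x)"])
    show "incseq (\<lambda>n. ennreal (c n * y x))" if "x \<in> space M" for x
      using c_mono yb[OF that] by (auto simp: incseq_def intro!: ennreal_leI mult_right_mono)
    show "(\<lambda>n. ennreal (c n * y x)) \<longlonglongrightarrow> ennreal (y x)" for x
      using tendsto_mult[OF c_lim tendsto_const[of "y x"]] by (intro tendsto_ennrealI) simp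
    fix n
    have "(\<integral>\<^sup>+x. ennreal (c n * y x) \<partial>M) = ennreal (c n) * (\<integral>\<^sup>+x. ennreal (y x) \<partial>M)"
      using c[of n] yb by (simp add: nn_integral_cmult[symmetric] ennreal_mult cong: nn_integral_cong_simp)
    also have "\<dots> \<le> ennreal (c n)"
      using mult_left_mono[OF int, of "ennreal (c n)"] by simp
    finally have "(\<integral>\<^sup>+x. ennreal (c n * y x) \<partial>M) \<le> ennreal (c n)" .
    moreover have "0 \<le> c n * y x \<and> c n * y x \<le> N" if "x \<in> space M" for x
      using c[of n] yb[OF that] mult_right_mono[of "c n" 1 "y x"] by auto
    ultimately show "acceptable (\<lambda>x. ennreal (c n * y x))"
      using c[of n] N by (intro acceptable_bounded_if_nn_integral_less[where N = N and c = "c n"]) auto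
  qed auto
qed

section \<open>Unbounded losses and the expectation criterion\<close>

lemma acceptable_iff_nn_integral_le:
  assumes [measurable]: "V \<in> borel_measurable M"
  shows "acceptable V \<longleftrightarrow> (\<integral>\<^sup>+x. V x \<partial>M) \<le> 1"
proof -
  \<comment> \<open>Truncation starts at 2 because the bounded case asks for a bound strictly above
    1. Monotone convergence handles the integrals, continuity from below the acceptability.\<close>
  define Z where "Z n x = min (V x) (of_nat (n + 2))" for n :: nat and x
  have [measurable]: "Z n \<in> borel_measurable M" for n
    unfolding Z_def by measurable
  have inc: "incseq (\<lambda>n. Z n x)" for x
    by (auto simp: incseq_def Z_def min.coboundedI2 le_infI2)
  have lim: "(\<lambda>n. Z n x) \<longlonglongrightarrow> V x" for x
  proof -
    have "(\<lambda>n. of_nat (n + 2) :: ennreal) \<longlonglongrightarrow> top"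
      by (rule LIMSEQ_ignore_initial_segment[OF of_nat_tendsto_top_ennreal])
    from tendsto_min[OF tendsto_const this, of "V x"] show ?thesis
      by (simp add: Z_def)
  qed
  have sup: "(SUP n. Z n x) = V x" for x
    using LIMSEQ_unique[OF LIMSEQ_SUP[OF inc] lim] .
  define y where "y n x = enn2real (Z n x)" for n x
  have [measurable]: "y n \<in> borel_measurable M" for n
    unfolding y_def by measurable
  have Z_le: "Z n x \<le> ennreal (real n + 2)" for n x
    by (simp add: Z_def ennreal_of_nat_eq_real_of_nat add.commute)
  have y: "ennreal (y n x) = Z n x" for n x
    using Z_le[of n x] unfolding y_def by (intro ennreal_enn2real) (auto simp: less_top[symmetric] top_unique)
  have yb: "0 \<le> y n x \<and> y n x \<le> real n + 2" for n x
    using Z_le[of n x] y[of n x] unfolding y_def by (metis enn2real_leI enn2real_nonneg of_nat_0_le_iff add_nonneg_nonneg zero_le_numeral)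
  show ?thesis
  proof
    assume "acceptable V"
    then have "acceptable (Z n)" for n
      by (rule acceptable_mono) (auto simp: Z_def)
    then have "(\<integral>\<^sup>+x. Z n x \<partial>M) \<le> 1" for n
      using nn_integral_le_1_if_acceptable_bounded[of "y n" "real n + 2"] yb by (simp add: y)
    then have "(SUP n. \<integral>\<^sup>+x. Z n x \<partial>M) \<le> 1"
      by (rule SUP_least)
    moreover have "incseq Z"
      using inc by (auto simp: incseq_def le_fun_def)
    ultimately show "(\<integral>\<^sup>+x. V x \<partial>M) \<le> 1"
      using nn_integral_monotone_convergence_SUP[of Z M] by (simp add: sup)
  next
    assume V: "(\<integral>\<^sup>+x. V x \<partial>M) \<le> 1"
    have "(\<integral>\<^sup>+x. Z n x \<partial>M) \<le> (\<integral>\<^sup>+x. V x \<partial>M)" for n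
      by (intro nn_integral_mono) (simp add: Z_def)
    then have "acceptable (Z n)" for n
      using acceptable_bounded[of "y n" "real n + 2"] yb V by (fastforce simp: y intro: order_trans)
    then show "acceptable V"
      using inc lim by (intro acceptable_lim[where Z = Z and V = V]) auto
  qed
qed

text \<open>By the tower property the conditional loss and the loss have the same expectation, so
  the conditioning on the level disappears.\<close>

lemma valid_iff_nn_integral_le:
  assumes "admissible M d L \<phi> a"
  shows "valid_for M \<rho> L C \<phi> a \<longleftrightarrow> (\<integral>\<^sup>+x. ennreal (nl (test_at \<phi> a x)) \<partial>M) \<le> 1"
proof -
  let ?F = "vimage_algebra (space M) a borel"
  have a: "a \<in> borel_measurable M" and L: "(\<lambda>x. L (test_at \<phi> a x)) \<in> borel_measurable M"
    using assms by (auto simp: admissible_def data_dependent_level_def)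
  have [measurable]: "(\<lambda>x. nl (test_at \<phi> a x)) \<in> borel_measurable M"
    using L unfolding normalized_loss_def by measurable
  interpret F: sigma_finite_subalgebra M ?F
    by (rule sigma_finite_subalgebra_vimage[OF a])
  have "(\<integral>\<^sup>+x. nn_cond_exp M ?F (\<lambda>x. ennreal (nl (test_at \<phi> a x))) x \<partial>M) =
        (\<integral>\<^sup>+x. ennreal (nl (test_at \<phi> a x)) \<partial>M)"
    using F.nn_cond_exp_intg[of "\<lambda>_. 1" "\<lambda>x. ennreal (nl (test_at \<phi> a x))"] by simp
  then show ?thesis
    unfolding valid_iff_acceptable[OF a L] by (simp add: acceptable_iff_nn_integral_le)
qed

end

theorem theorem5:
  fixes M :: "'a measure"
    and d :: "real \<Rightarrow> 'd::{linorder, order_bot}"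
    and L :: "'d \<Rightarrow> real"
    and C :: real
    and \<rho> :: "('a \<Rightarrow> ereal) \<Rightarrow> ereal"
  assumes "prob_space M"
    and "external_randomization M"
    and "evidence_levels d"
    and "mono L"
    and "L bot < C"
    and "certainty_equivalent M (ereal (L bot)) \<rho>"
    and "continuous_from_below M (ereal (L bot)) \<rho>"
    and "nests_classical M d (valid_for M \<rho> L C)"
    and "preserves_classical M d L (valid_for M \<rho> L C)"
    and "monotone_validity M d L (valid_for M \<rho> L C)"
  shows "(\<forall>\<alpha>\<in>{0<..<1}. normalized_loss L C (d \<alpha>) = 1 / \<alpha>) \<and>
         (\<forall>\<phi> a. admissible M d L \<phi> a \<longrightarrow>
            (valid_for M \<rho> L C \<phi> a \<longleftrightarrow>
             (\<integral>\<^sup>+ x. ennreal (normalized_loss L C (test_at \<phi> a x)) \<partial>M) \<le> 1))"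
  proof -
  interpret certainty_equivalent_validity M d L C \<rho>
    using assms by (simp add: certainty_equivalent_validity_def certainty_equivalent_validity_axioms_def)
  show ?thesis
    using nl_d valid_iff_nn_integral_le by blast
qed

end
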